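(* Let $G=(V,E)$ be a finite directed graph with nonnegative edge distances $d_e$ and losses $l_e$, source $s$ and destination $t$, and for an $s$-$t$ path $P$ let $d(P)=\sum_{e\in P}d_e$, $l(P)=\sum_{e\in P}l_e$, assumed to satisfy $d(P)>0$. Let $\kappa=\frac{20}{\ln 10}$ and $f(P)=l(P)+\kappa\ln d(P)$, and let $(d^*,l^* )$ be the distance-loss pair of a dominant $s$-$t$ path (one minimizing $f$). Fix $r>1$, choose $u$ uniformly at random from $(0,1)$, set $\lambda_0=r^u$ and $\lambda_i=\lambda_0 r^i$ for $i\in\mathbb{Z}$. The geometric progression algorithm $\mathrm{GP}_{r,\lambda_0}$ computes, for each $i$, an $s$-$t$ path $P_i$ minimizing $l(P)+\lambda_i d(P)$, and outputs the path $P$ among the $P_i$ with smallest $f$. Then $$\mathbb{E}[f(P)]\le l^*+\kappa\ln d^*+\kappa\left(-\tfrac12\ln r+\ln(r-1)-\ln\ln r\right),$$ where the expectation is over the random choice of $u$ (the input is arbitrary).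
   Context: In the application (indoor dominant path model), $f$ is the modeled path loss in dB up to an additive constant, with $d$ Euclidean path length and $l$ total penetration plus diffraction loss; $\kappa\approx 8.686$ dB. *)

theory Defs
  imports "HOL-Probability.Probability" "Graph_Theory.Shortest_Path"
begin

definition kappa :: real where
  "kappa = 20 / ln 10"

context wf_digraph
begin

definition dominant_cost :: "'b weight_fun \<Rightarrow> 'b weight_fun \<Rightarrow> 'b awalk \<Rightarrow> real" where
  "dominant_cost d l p = awalk_cost l p + kappa * ln (awalk_cost d p)"

definition dominant_path :: "'b weight_fun \<Rightarrow> 'b weight_fun \<Rightarrow> 'a \<Rightarrow> 'a \<Rightarrow> 'b awalk \<Rightarrow> bool" where
  "dominant_path d l s t p \<longleftrightarrow> is_arg_min (dominant_cost d l) (\<lambda>q. apath s q t) p"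

definition linear_min_path ::
    "'b weight_fun \<Rightarrow> 'b weight_fun \<Rightarrow> 'a \<Rightarrow> 'a \<Rightarrow> real \<Rightarrow> 'b awalk \<Rightarrow> bool" where
  "linear_min_path d l s t lam p \<longleftrightarrow>
     is_arg_min (\<lambda>q. awalk_cost l q + lam * awalk_cost d q) (\<lambda>q. apath s q t) p"

text \<open>A relation rather than a function: ties, both in the choice of each \<open>P i\<close> and in the
  final choice among them, may be broken arbitrarily.\<close>

definition gp_output ::
    "'b weight_fun \<Rightarrow> 'b weight_fun \<Rightarrow> 'a \<Rightarrow> 'a \<Rightarrow> real \<Rightarrow> real \<Rightarrow> 'b awalk \<Rightarrow> bool" where
  "gp_output d l s t r lam0 p \<longleftrightarrow>
     (\<exists>P :: int \<Rightarrow> 'b awalk.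
        (\<forall>i. linear_min_path d l s t (lam0 * r powi i) (P i)) \<and>
        is_arg_min (dominant_cost d l) (\<lambda>q. q \<in> range P) p)"

end

end

theory Submission
  imports Defs
begin

text \<open>
  A minimizer of \<open>l + \<lambda> d\<close> with \<open>x = \<lambda> d\<^sup>* / \<kappa>\<close> exceeds the optimal value of \<open>f\<close> by at most
  \<open>\<kappa> (x - 1 - ln x)\<close>, because \<open>\<kappa> ln d - \<lambda> d\<close> is maximal at \<open>d = \<kappa> / \<lambda>\<close>. For every \<open>a > 0\<close> some
  \<open>\<lambda>\<^sub>i\<close> has \<open>x \<in> [a, a r)\<close>, and for that index \<open>log\<^sub>r (x / a)\<close> is uniform on \<open>[0, 1)\<close>. The expected
  excess is therefore at most \<open>\<kappa> (a (r - 1) / ln r - 1 - ln a - ln r / 2)\<close>, which is minimal at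
  \<open>a = ln r / (r - 1)\<close>. Measurability of the cost of the output holds for every way of breaking ties,
  as ties between different distance-loss pairs occur for countably many \<open>u\<close> only.
\<close>

definition ln_tangent_gap :: "real \<Rightarrow> real" where
  "ln_tangent_gap x = x - 1 - ln x"

lemma linear_cost_le_imp_ln_cost_le:
  fixes k lam l l' d d' :: real
  assumes "0 < k" "0 < lam" "0 < d" "0 < d'"
    and "l + lam * d \<le> l' + lam * d'"
  shows "l + k * ln d \<le> l' + k * ln d' + k * ln_tangent_gap (lam * d' / k)"
proof -
  have "k * ln (lam * d / k) \<le> k * (lam * d / k - 1)"
    using assms by (intro mult_left_mono ln_le_minus_one) simp_all
  then show ?thesis
    using assms by (simp add: ln_tangent_gap_def ln_mult ln_div algebra_simps)
qed

lemma powr_times_powi_floor_eq: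
  fixes r c u :: real
  assumes "0 < r" "r \<noteq> 1" "0 < c"
  shows "r powr u * r powi (- \<lfloor>u - log r c\<rfloor>) = c * r powr frac (u - log r c)"
proof -
  have "r powr u * r powi (- \<lfloor>u - log r c\<rfloor>) = r powr (u + of_int (- \<lfloor>u - log r c\<rfloor>))"
    using assms(1) by (subst powr_add, subst powr_real_of_int') auto
  also have "u + of_int (- \<lfloor>u - log r c\<rfloor>) = log r c + frac (u - log r c)"
    by (simp add: frac_def)
  also have "r powr \<dots> = c * r powr frac (u - log r c)"
    using assms by (simp add: powr_add)
  finally show ?thesis .
qed

lemma countable_powi_preimage:
  fixes r :: "'a :: field"
  assumes "r \<noteq> 0" "countable A"
  shows "countable {x. \<exists>i. x * r powi i \<in> A}"
proof (rule countable_subset)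
  show "{x. \<exists>i. x * r powi i \<in> A} \<subseteq> (\<lambda>(i, y). y / r powi i) ` (UNIV \<times> A)"
  proof clarify
    fix x i assume "x * r powi i \<in> A"
    then show "x \<in> (\<lambda>(i, y). y / r powi i) ` (UNIV \<times> A)"
      using assms(1) by (intro image_eqI[of _ _ "(i, x * r powi i)"]) auto
  qed
  show "countable ((\<lambda>(i :: int, y). y / r powi i) ` (UNIV \<times> A))"
    using assms(2) by (intro countable_image countable_SIGMA) auto
qed

lemma emeasure_lborel_vimage_plus:
  fixes c :: "'a :: euclidean_space"
  assumes "A \<in> sets borel"
  shows "emeasure lborel ((+) c -` A) = emeasure lborel A"
  using assms by (subst (2) lborel_distr_plus[of c, symmetric]) (simp add: emeasure_distr)

lemma emeasure_lborel_frac_diff: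
  fixes c :: real
  assumes A: "A \<in> sets borel"
  shows "emeasure lborel ({0..<1} \<inter> (\<lambda>u. frac (u - c)) -` A) = emeasure lborel ({0..<1} \<inter> A)"
proof -
  define e where "e = frac c"
  have e: "0 \<le> e" "e < 1"
    by (simp_all add: e_def frac_lt_1)
  let ?wrapped = "(+) (1 - e) -` ({1 - e..<1} \<inter> A)"
  let ?shifted = "(+) (- e) -` ({0..<1 - e} \<inter> A)"
  have wrap: "frac (u - c) = 1 - e + u" if "u \<in> {0..<1}" "u < e" for u
    using that frac_diff_neg[of u c] by (simp add: e_def)
  have shift: "frac (u - c) = - e + u" if "u \<in> {0..<1}" "e \<le> u" for u
    using that frac_diff_pos[of c u] by (simp add: e_def)
  have "{0..<1} \<inter> (\<lambda>u. frac (u - c)) -` A = ?wrapped \<union> ?shifted"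
  proof (intro set_eqI)
    show "u \<in> {0..<1} \<inter> (\<lambda>u. frac (u - c)) -` A \<longleftrightarrow> u \<in> ?wrapped \<union> ?shifted" for u
      using e wrap[of u] shift[of u] by (cases "u < e") auto
  qed
  moreover have "?wrapped \<inter> ?shifted = {}"
    by auto
  moreover have "?wrapped \<in> sets lborel" "?shifted \<in> sets lborel"
    using A by (auto intro!: measurable_sets_borel)
  ultimately have "emeasure lborel ({0..<1} \<inter> (\<lambda>u. frac (u - c)) -` A) =
      emeasure lborel ?wrapped + emeasure lborel ?shifted"
    by (simp add: plus_emeasure)
  also have "\<dots> = emeasure lborel ({1 - e..<1} \<inter> A) + emeasure lborel ({0..<1 - e} \<inter> A)"
    using A by (simp add: emeasure_lborel_vimage_plus del: vimage_Int)
  also have "\<dots> = emeasure lborel (({1 - e..<1} \<inter> A) \<union> ({0..<1 - e} \<inter> A))"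
    using A by (intro plus_emeasure) auto
  also have "({1 - e..<1} \<inter> A) \<union> ({0..<1 - e} \<inter> A) = {0..<1} \<inter> A"
    using e by auto
  finally show ?thesis .
qed

lemma uniform_measure_lborel_Ioo_eq_Ico:
  "uniform_measure lborel {a<..<b} = uniform_measure lborel {a..<b :: real}"
  unfolding uniform_measure_def
proof (rule density_cong)
  have "AE x in lborel. x \<noteq> a"
    by (rule AE_lborel_singleton)
  then show "AE x in lborel. indicator {a<..<b} x / emeasure lborel {a<..<b} =
      (indicator {a..<b} x / emeasure lborel {a..<b} :: ennreal)"
    by eventually_elim (cases "a \<le> b"; auto simp: indicator_def)
qed auto

lemma has_bochner_integral_uniform_measure_FTC:
  fixes f F :: "real \<Rightarrow> 'a :: euclidean_space"
  assumes ab: "a < b"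
    and F: "\<And>x. x \<in> {a..b} \<Longrightarrow> (F has_vector_derivative f x) (at x within {a..b})"
    and cont: "continuous_on {a..b} f"
    and meas: "f \<in> borel_measurable borel"
  shows "has_bochner_integral (uniform_measure lborel {a<..<b}) f ((F b - F a) /\<^sub>R (b - a))"
proof -
  have "has_bochner_integral lborel (\<lambda>x. indicator {a..b} x *\<^sub>R f x) (F b - F a)"
    using ab F cont by (intro has_bochner_integral_FTC_Icc) auto
  then have "has_bochner_integral lborel (\<lambda>x. indicator {a<..<b} x *\<^sub>R f x) (F b - F a)"
    by (rule has_bochner_integral_discrete_difference[where X="{a, b}", THEN iffD1, rotated -1])
      (auto simp: indicator_def)
  then have "has_bochner_integral lborel (\<lambda>x. (indicator {a<..<b} x *\<^sub>R f x) /\<^sub>R (b - a))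
      ((F b - F a) /\<^sub>R (b - a))"
    by (rule has_bochner_integral_scaleR_right)
  then have "has_bochner_integral lborel (\<lambda>x. (indicator {a<..<b} x / (b - a)) *\<^sub>R f x)
      ((F b - F a) /\<^sub>R (b - a))"
    by (simp add: divide_inverse mult.commute)
  then have "has_bochner_integral (density lborel (\<lambda>x. ennreal (indicator {a<..<b} x / (b - a)))) f
      ((F b - F a) /\<^sub>R (b - a))"
    using ab meas by (intro has_bochner_integral_density) auto
  also have "density lborel (\<lambda>x. ennreal (indicator {a<..<b} x / (b - a))) =
      uniform_measure lborel {a<..<b}"
    using ab unfolding uniform_measure_def
    by (intro density_cong)
      (auto simp: divide_ennreal simp del: ennreal_indicator simp flip: ennreal_indicator)
  finally show ?thesis .
qed

abbreviation uniform01 :: "real measure" where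
  "uniform01 \<equiv> uniform_measure lborel {0<..<1}"

lemma prob_space_uniform01: "prob_space uniform01"
  by (rule prob_space_uniform_measure) auto

lemma borel_measurable_frac_diff [measurable]:
  "(\<lambda>u. frac (u - c)) \<in> borel_measurable (borel :: real measure)"
  unfolding frac_def by measurable

lemma distr_uniform01_frac_diff:
  fixes c :: real
  shows "distr uniform01 borel (\<lambda>u. frac (u - c)) = uniform01"
proof (rule measure_eqI)
  fix A assume "A \<in> sets (distr uniform01 borel (\<lambda>u. frac (u - c)))"
  then have A: "A \<in> sets borel"
    by simp
  then have "(\<lambda>u. frac (u - c)) -` A \<in> sets borel"
    by (rule measurable_sets_borel[rotated]) measurable
  then show "emeasure (distr uniform01 borel (\<lambda>u. frac (u - c))) A = emeasure uniform01 A"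
    using A
    by (simp add: uniform_measure_lborel_Ioo_eq_Ico emeasure_distr emeasure_lborel_frac_diff)
qed simp

lemma has_bochner_integral_uniform01_frac_diff:
  fixes f :: "real \<Rightarrow> 'a :: {banach, second_countable_topology}" and c :: real
  assumes f: "has_bochner_integral uniform01 f I"
  shows "has_bochner_integral uniform01 (\<lambda>u. f (frac (u - c))) I"
proof -
  have "has_bochner_integral (distr uniform01 borel (\<lambda>u. frac (u - c))) f I"
    using f by (simp only: distr_uniform01_frac_diff)
  moreover have "f \<in> borel_measurable borel"
    using borel_measurable_has_bochner_integral[OF f] by simp
  ultimately show ?thesis
    by (simp add: has_bochner_integral_iff integrable_distr_eq integral_distr)
qed

lemma has_bochner_integral_uniform01_ln_tangent_gap:
  assumes r: "1 < r" and a: "0 < a"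
  shows "has_bochner_integral uniform01 (\<lambda>v. ln_tangent_gap (a * r powr v))
    (a * (r - 1) / ln r - 1 - ln a - ln r / 2)"
proof -
  define F where "F = (\<lambda>v. a * r powr v / ln r - v - ln a * v - ln r * v\<^sup>2 / 2)"
  have gap: "(\<lambda>v. ln_tangent_gap (a * r powr v)) = (\<lambda>v. a * r powr v - 1 - (ln a + v * ln r))"
    using r a by (simp add: ln_tangent_gap_def ln_mult ln_powr fun_eq_iff)
  have cont: "continuous_on UNIV (\<lambda>v. ln_tangent_gap (a * r powr v))"
    unfolding gap using r by (intro continuous_intros) auto
  have "(F has_real_derivative ln_tangent_gap (a * r powr v)) (at v)" for v
    unfolding F_def gap[THEN fun_cong] using r
    by (auto intro!: derivative_eq_intros simp: field_simps power2_eq_square)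
  then have "(F has_vector_derivative ln_tangent_gap (a * r powr v)) (at v within {0..1})" for v
    by (simp add: has_field_derivative_at_within flip: has_real_derivative_iff_has_vector_derivative)
  then have "has_bochner_integral uniform01
      (\<lambda>v. ln_tangent_gap (a * r powr v)) ((F 1 - F 0) /\<^sub>R (1 - 0))"
    using cont
    by (intro has_bochner_integral_uniform_measure_FTC)
      (auto intro: continuous_on_subset borel_measurable_continuous_onI)
  also have "(F 1 - F 0) /\<^sub>R (1 - 0) = a * (r - 1) / ln r - 1 - ln a - ln r / 2"
    using r by (simp add: F_def diff_divide_distrib right_diff_distrib)
  finally show ?thesis .
qed

lemma kappa_pos: "0 < kappa"
  by (simp add: kappa_def)

context wf_digraph
begin

definition linear_cost :: "'b weight_fun \<Rightarrow> 'b weight_fun \<Rightarrow> real \<Rightarrow> 'b awalk \<Rightarrow> real" where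
  "linear_cost d l lam p = awalk_cost l p + lam * awalk_cost d p"

lemma linear_min_path_iff:
  "linear_min_path d l s t lam p \<longleftrightarrow>
    apath s p t \<and> (\<forall>q. apath s q t \<longrightarrow> linear_cost d l lam p \<le> linear_cost d l lam q)"
  by (auto simp: linear_min_path_def linear_cost_def is_arg_min_linorder)

lemma dominant_cost_linear_min_path_le:
  assumes p: "linear_min_path d l s t lam p" and Q: "apath s Q t"
    and "0 < lam" "0 < awalk_cost d p" "0 < awalk_cost d Q"
  shows "dominant_cost d l p \<le>
    dominant_cost d l Q + kappa * ln_tangent_gap (lam * awalk_cost d Q / kappa)"
  unfolding dominant_cost_def using assms kappa_pos
  by (intro linear_cost_le_imp_ln_cost_le) (auto simp: linear_min_path_iff linear_cost_def)

lemma gp_output_linear_min_path: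
  assumes "gp_output d l s t r lam0 p"
  obtains i where "linear_min_path d l s t (lam0 * r powi i) p"
  using assms by (auto simp: gp_output_def is_arg_min_linorder)

lemma gp_output_apath: "gp_output d l s t r lam0 p \<Longrightarrow> apath s p t"
  by (metis gp_output_linear_min_path linear_min_path_iff)

lemma gp_output_dominant_cost_le_linear_min_path:
  assumes "gp_output d l s t r lam0 p"
  obtains q where "linear_min_path d l s t (lam0 * r powi i) q"
    "dominant_cost d l p \<le> dominant_cost d l q"
  using assms by (force simp: gp_output_def is_arg_min_linorder)

lemma gp_output_dominant_cost_le:
  fixes u :: real
  assumes r: "1 < r" and a: "0 < a"
    and pos: "\<And>p. apath s p t \<Longrightarrow> 0 < awalk_cost d p"
    and Q: "apath s Q t"
    and p: "gp_output d l s t r (r powr u) p"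
  shows "dominant_cost d l p \<le> dominant_cost d l Q +
    kappa * ln_tangent_gap (a * r powr frac (u - log r (a * kappa / awalk_cost d Q)))"
proof -
  define c where "c = a * kappa / awalk_cost d Q"
  define lam where "lam = r powr u * r powi (- \<lfloor>u - log r c\<rfloor>)"
  have "0 < c"
    using a pos[OF Q] kappa_pos by (simp add: c_def)
  then have "lam = c * r powr frac (u - log r c)"
    unfolding lam_def using r by (intro powr_times_powi_floor_eq) auto
  then have lam: "lam * awalk_cost d Q / kappa = a * r powr frac (u - log r c)"
    using pos[OF Q] kappa_pos by (simp add: c_def)
  obtain q where q: "linear_min_path d l s t lam q" "dominant_cost d l p \<le> dominant_cost d l q"
    using gp_output_dominant_cost_le_linear_min_path[OF p] unfolding lam_def .
  note q(2)
  also have "dominant_cost d l q \<le>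
      dominant_cost d l Q + kappa * ln_tangent_gap (lam * awalk_cost d Q / kappa)"
    using q(1) Q pos r
    by (intro dominant_cost_linear_min_path_le) (auto simp: linear_min_path_iff lam_def)
  finally show ?thesis
    unfolding lam c_def .
qed

definition tie_multipliers :: "'b weight_fun \<Rightarrow> 'b weight_fun \<Rightarrow> 'a \<Rightarrow> 'a \<Rightarrow> real set" where
  "tie_multipliers d l s t = {lam. \<exists>p q. apath s p t \<and> apath s q t \<and>
     awalk_cost d p \<noteq> awalk_cost d q \<and> linear_cost d l lam p = linear_cost d l lam q}"

lemma linear_min_path_dominant_cost_eq:
  assumes p: "linear_min_path d l s t lam p" and q: "linear_min_path d l s t lam q"
    and lam: "lam \<notin> tie_multipliers d l s t"
  shows "dominant_cost d l p = dominant_cost d l q"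
proof -
  have "linear_cost d l lam p = linear_cost d l lam q"
    using p q by (auto simp: linear_min_path_iff intro: antisym)
  moreover from this have "awalk_cost d p = awalk_cost d q"
    using p q lam by (auto simp: tie_multipliers_def linear_min_path_iff)
  ultimately show ?thesis
    by (simp add: dominant_cost_def linear_cost_def)
qed

lemma gp_output_dominant_cost_le_iff:
  assumes p: "gp_output d l s t r lam0 p"
    and no_tie: "\<nexists>i. lam0 * r powi i \<in> tie_multipliers d l s t"
  shows "dominant_cost d l p \<le> x \<longleftrightarrow>
    (\<exists>i. \<exists>q\<in>{q. apath s q t \<and> dominant_cost d l q \<le> x}.
      linear_min_path d l s t (lam0 * r powi i) q)"
    (is "?L \<longleftrightarrow> ?R")
proof
  assume ?L
  moreover obtain i where "linear_min_path d l s t (lam0 * r powi i) p"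
    using gp_output_linear_min_path[OF p] .
  ultimately show ?R
    by (auto simp: linear_min_path_iff)
next
  assume ?R
  then obtain i q where q: "linear_min_path d l s t (lam0 * r powi i) q" "dominant_cost d l q \<le> x"
    by blast
  obtain q' where q': "linear_min_path d l s t (lam0 * r powi i) q'"
    "dominant_cost d l p \<le> dominant_cost d l q'"
    using gp_output_dominant_cost_le_linear_min_path[OF p] .
  have "dominant_cost d l q' = dominant_cost d l q"
    using q'(1) q(1) no_tie by (blast intro: linear_min_path_dominant_cost_eq)
  with q(2) q'(2) show ?L
    by simp
qed

lemma closed_linear_min_path: "closed {lam. linear_min_path d l s t lam p}"
  unfolding linear_min_path_iff linear_cost_def
  by (intro closed_Collect_conj closed_Collect_all closed_Collect_imp closed_Collect_le
      closed_Collect_const open_Collect_const continuous_intros)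

end

context fin_digraph
begin

lemma finite_tie_multipliers: "finite (tie_multipliers d l s t)"
proof (rule finite_surj)
  let ?paths = "{p. apath s p t}"
  let ?tie = "\<lambda>(p, q). (awalk_cost l q - awalk_cost l p) / (awalk_cost d p - awalk_cost d q)"
  show "finite (?paths \<times> ?paths)"
    using apaths_finite by blast
  show "tie_multipliers d l s t \<subseteq> ?tie ` (?paths \<times> ?paths)"
  proof
    fix lam assume "lam \<in> tie_multipliers d l s t"
    then obtain p q where pq: "apath s p t" "apath s q t" "awalk_cost d p \<noteq> awalk_cost d q"
      "linear_cost d l lam p = linear_cost d l lam q"
      by (auto simp: tie_multipliers_def)
    then have "lam = ?tie (p, q)"
      by (simp add: linear_cost_def field_simps)
    with pq(1,2) show "lam \<in> ?tie ` (?paths \<times> ?paths)"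
      by blast
  qed
qed

lemma borel_measurable_dominant_cost_gp:
  assumes r: "r \<noteq> 0" and S: "S \<in> sets borel"
    and GP: "\<And>lam0. lam0 \<in> S \<Longrightarrow> gp_output d l s t r lam0 (GP lam0)"
  shows "(\<lambda>lam0. dominant_cost d l (GP lam0)) \<in> borel_measurable (restrict_space borel S)"
  unfolding borel_measurable_iff_le pred_def[symmetric]
proof
  fix x
  let ?ties = "{lam0. \<exists>i. lam0 * r powi i \<in> tie_multipliers d l s t}"
  let ?good = "{q. apath s q t \<and> dominant_cost d l q \<le> x}"
  show "Measurable.pred (restrict_space borel S) (\<lambda>lam0. dominant_cost d l (GP lam0) \<le> x)"
  proof (rule measurable_discrete_difference)
    have "finite ?good"
      using apaths_finite by (rule rev_finite_subset) auto
    moreover have "closed ((\<lambda>lam0. lam0 * r powi i) -` {lam. linear_min_path d l s t lam q})" for i q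
      by (intro closed_vimage closed_linear_min_path continuous_intros)
    then have "Measurable.pred borel (\<lambda>lam0. linear_min_path d l s t (lam0 * r powi i) q)" for i q
      by (simp add: pred_def borel_closed vimage_def)
    ultimately show "Measurable.pred (restrict_space borel S)
        (\<lambda>lam0. \<exists>i. \<exists>q\<in>?good. linear_min_path d l s t (lam0 * r powi i) q)"
      by (intro measurable_restrict_space1) measurable
    show "countable (?ties \<inter> S)"
      using r finite_tie_multipliers
      by (intro countable_Int1 countable_powi_preimage countable_finite)
    show "{lam0} \<in> sets (restrict_space borel S)" if "lam0 \<in> ?ties \<inter> S" for lam0
      using that S by (simp add: sets_restrict_space_iff)
  qed (auto simp: space_restrict_space gp_output_dominant_cost_le_iff[OF GP])
qed

lemma integrable_dominant_cost_gp:
  assumes M: "finite_measure M" and r: "r \<noteq> 0"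
    and X: "X \<in> M \<rightarrow>\<^sub>M restrict_space borel S" and S: "S \<in> sets borel"
    and GP: "\<And>lam0. lam0 \<in> S \<Longrightarrow> gp_output d l s t r lam0 (GP lam0)"
  shows "integrable M (\<lambda>w. dominant_cost d l (GP (X w)))"
proof (intro integrable_simple_function simple_function_borel_measurable)
  show "(\<lambda>w. dominant_cost d l (GP (X w))) \<in> borel_measurable M"
    using borel_measurable_dominant_cost_gp[OF r S GP] by (rule measurable_compose[OF X])
  have "apath s (GP (X w)) t" if "w \<in> space M" for w
    using measurable_space[OF X that] by (auto simp: space_restrict_space intro: gp_output_apath GP)
  then have "(\<lambda>w. dominant_cost d l (GP (X w))) ` space M \<subseteq> dominant_cost d l ` {p. apath s p t}"
    by blast
  then show "finite ((\<lambda>w. dominant_cost d l (GP (X w))) ` space M)"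
    using apaths_finite by (rule finite_surj[rotated])
  show "emeasure M {w \<in> space M. dominant_cost d l (GP (X w)) \<noteq> 0} \<noteq> \<infinity>"
    using finite_measure.emeasure_finite[OF M] by simp
qed

corollary integrable_dominant_cost_gp_uniform01:
  assumes r: "1 < r"
    and GP: "\<And>lam0. 0 < lam0 \<Longrightarrow> gp_output d l s t r lam0 (GP lam0)"
  shows "integrable uniform01 (\<lambda>u. dominant_cost d l (GP (r powr u)))"
proof (rule integrable_dominant_cost_gp[where S = "{0<..}"])
  show "finite_measure uniform01"
    using prob_space_uniform01 by (rule prob_space.finite_measure)
  show "(\<lambda>u. r powr u) \<in> uniform01 \<rightarrow>\<^sub>M restrict_space borel {0<..}"
    using r by (intro measurable_restrict_space2) auto
  show "gp_output d l s t r lam0 (GP lam0)" if "lam0 \<in> {0<..}" for lam0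
    using that by (intro GP) simp
qed (use r in auto)

lemma expectation_dominant_cost_gp_le:
  assumes r: "1 < r" and a: "0 < a"
    and pos: "\<And>p. apath s p t \<Longrightarrow> 0 < awalk_cost d p"
    and Q: "apath s Q t"
    and GP: "\<And>lam0. 0 < lam0 \<Longrightarrow> gp_output d l s t r lam0 (GP lam0)"
  shows "integral\<^sup>L uniform01 (\<lambda>u. dominant_cost d l (GP (r powr u)))
    \<le> dominant_cost d l Q + kappa * (a * (r - 1) / ln r - 1 - ln a - ln r / 2)"
proof -
  interpret U: prob_space uniform01
    by (rule prob_space_uniform01)
  define gap where
    "gap = (\<lambda>u. ln_tangent_gap (a * r powr frac (u - log r (a * kappa / awalk_cost d Q))))"
  have gap: "has_bochner_integral uniform01 gap (a * (r - 1) / ln r - 1 - ln a - ln r / 2)"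
    unfolding gap_def
    using has_bochner_integral_uniform01_ln_tangent_gap[OF r a]
    by (rule has_bochner_integral_uniform01_frac_diff)
  have "dominant_cost d l (GP (r powr u)) \<le> dominant_cost d l Q + kappa * gap u" for u
    unfolding gap_def using r a pos Q GP by (intro gp_output_dominant_cost_le) auto
  then have "U.expectation (\<lambda>u. dominant_cost d l (GP (r powr u)))
      \<le> U.expectation (\<lambda>u. dominant_cost d l Q + kappa * gap u)"
    using integrable_dominant_cost_gp_uniform01[OF r GP] gap
    by (intro integral_mono) (auto simp: has_bochner_integral_iff)
  also have "\<dots> = dominant_cost d l Q + kappa * (a * (r - 1) / ln r - 1 - ln a - ln r / 2)"
    using gap U.prob_space by (simp add: has_bochner_integral_iff)
  finally show ?thesis .
qed

end

theorem theorem5: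
  fixes G :: "('a, 'b) pre_digraph"
    and d l :: "'b \<Rightarrow> real"
    and s t :: 'a
    and Pstar :: "'b list"
    and dstar lstar r :: real
    and GP :: "real \<Rightarrow> 'b list"
  assumes "fin_digraph G"
    and "\<And>e. e \<in> arcs G \<Longrightarrow> 0 \<le> d e"
    and "\<And>e. e \<in> arcs G \<Longrightarrow> 0 \<le> l e"
    and "\<And>p. pre_digraph.apath G s p t \<Longrightarrow> 0 < wf_digraph.awalk_cost d p"
    and "wf_digraph.dominant_path G d l s t Pstar"
    and "dstar = wf_digraph.awalk_cost d Pstar"
    and "lstar = wf_digraph.awalk_cost l Pstar"
    and "1 < r"
    and "\<And>lam0. 0 < lam0 \<Longrightarrow> wf_digraph.gp_output G d l s t r lam0 (GP lam0)"
  shows "integrable (uniform_measure lborel {0<..<1})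
           (\<lambda>u. wf_digraph.dominant_cost d l (GP (r powr u)))
       \<and> integral\<^sup>L (uniform_measure lborel {0<..<1})
           (\<lambda>u. wf_digraph.dominant_cost d l (GP (r powr u)))
         \<le> lstar + kappa * ln dstar
             + kappa * (- (1 / 2) * ln r + ln (r - 1) - ln (ln r))"
proof -
  interpret fin_digraph G
    by fact
  let ?a = "ln r / (r - 1)"
  have a: "0 < ?a"
    using assms(8) by simp
  have "apath s Pstar t"
    using assms(5) by (simp add: dominant_path_def is_arg_min_def)
  from expectation_dominant_cost_gp_le[OF assms(8) a assms(4) this assms(9)]
  have "integral\<^sup>L (uniform_measure lborel {0<..<1}) (\<lambda>u. dominant_cost d l (GP (r powr u)))
      \<le> lstar + kappa * ln dstar + kappa * (?a * (r - 1) / ln r - 1 - ln ?a - ln r / 2)"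
    by (simp add: dominant_cost_def assms(6,7))
  also have "?a * (r - 1) / ln r - 1 - ln ?a - ln r / 2 =
      - (1 / 2) * ln r + ln (r - 1) - ln (ln r)"
    using assms(8) by (simp add: ln_div)
  finally show ?thesis
    using integrable_dominant_cost_gp_uniform01[OF assms(8,9)] by blast
qed

end
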